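(* Let $m\ge 2$ be an integer and let $a,b$ be complex numbers. Then $$\theta(q,a)=\sum_{k=0}^{m-1}\frac{(q^{m-k};q)_k\,(bq^{k-m+1})^k}{(q;q)_k\,Q_m(bq^{1-m})}\,P_m(aq^k,bq^k).$$
   Context: $q$ is a complex number with $0<|q|<1$. For an integer $n$: $(x;q)_\infty=\prod_{i\ge0}(1-xq^i)$, $(x;q)_n=(x;q)_\infty/(xq^n;q)_\infty$, and $(x_1,\dots,x_r;q)_n=(x_1;q)_n\cdots(x_r;q)_n$ (same for $n=\infty$). The partial theta function is $\theta(q,x)=\sum_{n=0}^\infty(-1)^nq^{\binom n2}x^n$. For an integer $m\ge2$, $$P_m(a,b)=(q,a,b;q)_\infty\sum_{n=0}^\infty\frac{(ab/q^m;q)_{2n}}{(q,a,b,ab/q^m;q)_n}q^n,$$ $$Q_m(b)=\sum_{i=0}^{m-2}\frac{(q^{2-m};q)_i}{(q;q)_i\,(bq^i;q)_{m-1}}(1-bq^{2i})\,b^{2i}q^{(2i-2+m)i}.$$ The identity is understood for parameters for which no denominator occurring in it vanishes (in particular $Q_m(bq^{1-m})\neq0$). *)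

theory Defs
  imports "HOL-Analysis.Analysis"
begin

definition qpoch_inf :: "complex \<Rightarrow> complex \<Rightarrow> complex" where
  "qpoch_inf x q = (\<Prod>i. 1 - x * q ^ i)"

(* The quotient (x;q)_inf / (x q^n;q)_inf, for a nonnegative index n. The finite product
   also covers the indeterminate cases x = q^(-j), such as (q^(2-m);q)_i with i <= m - 2,
   where the literal quotient is 0/0; see qpoch_eq_quotient for the agreement otherwise. *)
definition qpoch :: "complex \<Rightarrow> complex \<Rightarrow> nat \<Rightarrow> complex" where
  "qpoch x q n = (\<Prod>i<n. 1 - x * q ^ i)"

definition qpochs_inf :: "complex list \<Rightarrow> complex \<Rightarrow> complex" where
  "qpochs_inf xs q = (\<Prod>x\<leftarrow>xs. qpoch_inf x q)"

definition qpochs :: "complex list \<Rightarrow> complex \<Rightarrow> nat \<Rightarrow> complex" where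
  "qpochs xs q n = (\<Prod>x\<leftarrow>xs. qpoch x q n)"

lemma convergent_prod_qpoch:
  fixes x q :: complex
  assumes "norm q < 1"
  shows "convergent_prod (\<lambda>i. 1 - x * q ^ i)"
proof -
  have "summable (\<lambda>i. norm x * norm q ^ i)"
    using assms by (intro summable_mult summable_geometric) simp
  hence "summable (\<lambda>i. norm ((1 - x * q ^ i) - 1))"
    by (simp add: norm_mult norm_power)
  thus ?thesis
    by (intro abs_convergent_prod_imp_convergent_prod)
       (simp only: abs_convergent_prod_conv_summable)
qed

lemma qpoch_eq_quotient:
  assumes "norm q < 1" and nz: "qpoch_inf (x * q ^ n) q \<noteq> 0"
  shows "qpoch x q n = qpoch_inf x q / qpoch_inf (x * q ^ n) q"
proof -
  have shift: "(\<lambda>i. 1 - x * q ^ n * q ^ i) = (\<lambda>i. 1 - x * q ^ (i + n))"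
    by (simp add: power_add mult_ac)
  have conv: "convergent_prod (\<lambda>i. 1 - x * q ^ (i + n))"
    using convergent_prod_qpoch[OF assms(1), of "x * q ^ n"] by (simp only: shift)
  have "qpoch_inf x q = qpoch_inf (x * q ^ n) q * qpoch x q n"
  proof (cases "\<exists>i<n. 1 - x * q ^ i = 0")
    case True
    then obtain i where i: "i < n" "1 - x * q ^ i = 0" by blast
    have "(\<lambda>i. 1 - x * q ^ i) has_prod qpoch_inf x q"
      unfolding qpoch_inf_def using convergent_prod_qpoch[OF assms(1)]
      by (rule convergent_prod_has_prod)
    from this i(2) have "qpoch_inf x q = 0"
      by (rule has_prod_zeroI)
    moreover have "qpoch x q n = 0"
      unfolding qpoch_def using i by (intro prod_zero) auto
    ultimately show ?thesis by simp
  next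
    case False
    show ?thesis
      unfolding qpoch_inf_def qpoch_def shift
      by (rule prodinf_split_initial_segment[OF convergent_prod_qpoch[OF assms(1)]])
         (use False in auto)
  qed
  thus ?thesis using nz by simp
qed

definition partial_theta :: "complex \<Rightarrow> complex \<Rightarrow> complex" where
  "partial_theta q x = (\<Sum>n. (-1) ^ n * q ^ (n choose 2) * x ^ n)"

definition P :: "complex \<Rightarrow> nat \<Rightarrow> complex \<Rightarrow> complex \<Rightarrow> complex" where
  "P q m a b = qpochs_inf [q, a, b] q *
     (\<Sum>n. qpoch (a * b / q ^ m) q (2 * n) / qpochs [q, a, b, a * b / q ^ m] q n * q ^ n)"

definition Q :: "complex \<Rightarrow> nat \<Rightarrow> complex \<Rightarrow> complex" where
  "Q q m b = (\<Sum>i=0..m-2.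
     qpoch (q powi (2 - int m)) q i / (qpoch q q i * qpoch (b * q ^ i) q (m - 1)) *
     (1 - b * q ^ (2 * i)) * b ^ (2 * i) * q powi ((2 * int i - 2 + int m) * int i))"

definition P_denoms_nonzero :: "complex \<Rightarrow> nat \<Rightarrow> complex \<Rightarrow> complex \<Rightarrow> bool" where
  "P_denoms_nonzero q m a b \<longleftrightarrow> (\<forall>n. qpochs [q, a, b, a * b / q ^ m] q n \<noteq> 0)"

definition Q_denoms_nonzero :: "complex \<Rightarrow> nat \<Rightarrow> complex \<Rightarrow> bool" where
  "Q_denoms_nonzero q m b \<longleftrightarrow> (\<forall>i\<in>{0..m-2}. qpoch q q i * qpoch (b * q ^ i) q (m - 1) \<noteq> 0)"

end

theory Submission
  imports Defs "HOL-Computational_Algebra.Formal_Power_Series"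
begin

text \<open>
  Write \<open>e\<^sub>n(x) = (-1)\<^sup>n q\<^bsup>n(n-1)/2\<^esup> x\<^sup>n\<close>, so that \<open>\<theta>(q,x) = \<Sum>\<^sub>n e\<^sub>n(x)\<close>, write \<open>[n,k]\<close> for the Gaussian
  binomial coefficient, and put \<open>m = N + 2\<close>. The theorem is a statement about the double power series of
  \<open>P\<^sub>m\<close> in \<open>a\<close> and \<open>b\<close>: the weights on the right-hand side combine these series in such a way that the
  dependence on \<open>a\<close> splits off.

  Times the prefactor, the summand of \<open>P\<^sub>m\<close> is an entire function of \<open>a\<close> and \<open>b\<close>, namely
  \<open>q\<^sup>n (q\<^bsup>n+1\<^esup>, aq\<^sup>n, bq\<^sup>n; q)\<^sub>\<infinity> (abq\<^bsup>n-m\<^esup>; q)\<^sub>n\<close>. Expanding its factors by Euler's theorem and by the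
  \<open>q\<close>-binomial theorem gives an absolutely convergent quadruple series, in which the sum over \<open>n\<close> can be
  carried out by Euler's other theorem. Collecting powers of \<open>a\<close> and \<open>b\<close> yields
  \<open>P\<^sub>m(a,b) = \<Sum>\<^sub>i\<^sub>j A(i,j) e\<^sub>i(a) e\<^sub>j(b)\<close> with generating function
  \<open>\<Sum>\<^sub>j A(i,j) x\<^sup>j = (xq\<^bsup>-N\<^esup>; q)\<^sub>i / (x; q)\<^bsub>i+1\<^esub>\<close> (lemma \<open>P_expansion\<close>).

  The weights act on the row \<open>i\<close> as multiplication of this generating function by
  \<open>(xq\<^bsup>i-N\<^esup>; q)\<^bsub>N+1\<^esub>\<close>. The numerator becomes
  \<open>(xq\<^bsup>-N\<^esup>; q)\<^bsub>N+i+1\<^esub> = (xq\<^bsup>-N\<^esup>; q)\<^sub>N (x; q)\<^bsub>i+1\<^esub>\<close>, the denominator cancels, and the polynomial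
  \<open>(xq\<^bsup>-N\<^esup>; q)\<^sub>N\<close> which remains does not depend on \<open>i\<close> (lemma \<open>P_coeff_convolution\<close>). Hence the weighted
  sum is \<open>\<theta>(q,a)\<close> times a polynomial in \<open>b\<close>, which is \<open>H\<^sub>N(bq\<^bsup>1-m\<^esup>)\<close> with
  \<open>H\<^sub>N(c) = \<Sum>\<^sub>j [N,j] q\<^bsup>j\<^sup>2\<^esup> c\<^sup>j\<close> (lemma \<open>weighted_sum_P\<close>).

  It remains to see that \<open>Q\<^sub>m(c) = H\<^sub>N(c)\<close>. This is a finite Rogers--Ramanujan type identity, and it follows
  from two steps along the Bailey chain that starts at the unit Bailey pair (lemmas \<open>bailey_sum_0\<close>,
  \<open>bailey_sum_Suc\<close> and \<open>Q_eq_sum\<close>).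
\<close>

section \<open>Theta terms, finite products and Gaussian binomials\<close>

definition theta_term :: "complex \<Rightarrow> complex \<Rightarrow> nat \<Rightarrow> complex" where
  "theta_term q x n = (-1) ^ n * q ^ (n choose 2) * x ^ n"

text \<open>
  The quotient form is adequate here because \<open>(q;q)\<^sub>k\<close> never vanishes for \<open>0 < |q| < 1\<close>. The value \<open>0\<close> for
  \<open>k > n\<close> allows summation ranges to be extended freely.
\<close>

definition q_binomial :: "complex \<Rightarrow> nat \<Rightarrow> nat \<Rightarrow> complex" where
  "q_binomial q n k = (if k \<le> n then qpoch q q n / (qpoch q q k * qpoch q q (n - k)) else 0)"

lemma theta_term_0 [simp]: "theta_term q x 0 = 1"
  by (simp add: theta_term_def choose_two)

lemma theta_term_Suc: "theta_term q x (Suc n) = - x * q ^ n * theta_term q x n"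
  by (simp add: theta_term_def choose_two numeral_2_eq_2 power_add)

lemma theta_term_add: "theta_term q x (i + j) = theta_term q x i * theta_term q x j * q ^ (i * j)"
  by (induction j) (simp_all add: theta_term_Suc power_add algebra_simps)

lemma theta_term_mult: "theta_term q (x * y) n = theta_term q x n * y ^ n"
  by (simp add: theta_term_def power_mult_distrib)

text \<open>
  Two factors \<open>q\<^bsup>n(n-1)/2\<^esup>\<close> and one factor \<open>q\<^sup>n\<close> make up \<open>q\<^bsup>n\<^sup>2\<^esup>\<close>. This is how the theta terms of the
  expansion of \<open>P\<close> turn into the squares in the exponents of \<open>Q\<close> and of the weights.
\<close>

lemma theta_term_mult_theta_term:
  "theta_term q x n * theta_term q (q * y) n = (x * y) ^ n * q ^ (n * n)"
  by (induction n) (simp_all add: theta_term_Suc power_add algebra_simps)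

lemma qpoch_0 [simp]: "qpoch x q 0 = 1"
  by (simp add: qpoch_def)

lemma qpoch_Suc: "qpoch x q (Suc n) = qpoch x q n * (1 - x * q ^ n)"
  by (simp add: qpoch_def)

lemma qpoch_add: "qpoch x q (m + n) = qpoch x q m * qpoch (x * q ^ m) q n"
  by (induction n) (simp_all add: qpoch_Suc power_add mult_ac)

lemma qpoch_Suc_left: "qpoch x q (Suc n) = (1 - x) * qpoch (x * q) q n"
  using qpoch_add[of x q 1 n] by (simp add: qpoch_Suc)

text \<open>
  The product \<open>(xy;q)\<^sub>n\<close> as a formal power series in \<open>x\<close>.
\<close>

definition fps_qpoch :: "complex \<Rightarrow> complex \<Rightarrow> nat \<Rightarrow> complex fps" where
  "fps_qpoch y q n = (\<Prod>l<n. 1 - fps_const (y * q ^ l) * fps_X)"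

lemma fps_qpoch_Suc: "fps_qpoch y q (Suc n) = fps_qpoch y q n * (1 - fps_const (y * q ^ n) * fps_X)"
  by (simp add: fps_qpoch_def)

lemma fps_qpoch_add: "fps_qpoch y q (m + n) = fps_qpoch y q m * fps_qpoch (y * q ^ m) q n"
  by (induction n) (simp_all add: fps_qpoch_def power_add mult_ac)

text \<open>
  The expansion of \<open>1/(x;q)\<^bsub>i+1\<^esub>\<close> in powers of \<open>x\<close>; see \<open>fps_q_negbinomial_inverse\<close>.
\<close>

definition fps_q_negbinomial :: "complex \<Rightarrow> nat \<Rightarrow> complex fps" where
  "fps_q_negbinomial q i = Abs_fps (\<lambda>l. q_binomial q (i + l) i)"

lemma fps_nth_mult_linear:
  fixes F :: "complex fps"
  shows "fps_nth (F * (1 - fps_const c * fps_X)) k = fps_nth F k - c * (if k = 0 then 0 else fps_nth F (k - 1))"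
proof -
  have "F * (1 - fps_const c * fps_X) = F - fps_const c * (F * fps_X)"
    by (simp add: right_diff_distrib mult_ac)
  thus ?thesis by simp
qed

lemma q_binomial_eq_0: "k > n \<Longrightarrow> q_binomial q n k = 0"
  by (simp add: q_binomial_def)

lemma q_binomial_symmetric: "k \<le> n \<Longrightarrow> q_binomial q n (n - k) = q_binomial q n k"
  by (simp add: q_binomial_def mult.commute)

section \<open>Absolutely convergent sums\<close>

lemma summable_on_norm_mult_Times:
  fixes f :: "'a \<Rightarrow> complex" and g :: "'b \<Rightarrow> complex"
  assumes f: "(\<lambda>x. norm (f x)) summable_on A" and g: "(\<lambda>x. norm (g x)) summable_on B"
  shows "(\<lambda>z. norm (f (fst z) * g (snd z))) summable_on A \<times> B"
proof -
  have "(\<lambda>x. norm (f x) * (\<Sum>\<^sub>\<infinity>y\<in>B. norm (g y))) summable_on A"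
    using f by (rule summable_on_cmult_left)
  moreover have "norm (\<Sum>\<^sub>\<infinity>y\<in>B. norm (f x * g y)) = norm (f x) * (\<Sum>\<^sub>\<infinity>y\<in>B. norm (g y))" for x
    by (simp add: norm_mult infsum_cmult_right' infsum_nonneg)
  ultimately show ?thesis
    by (subst Infinite_Sum.abs_summable_on_Sigma_iff)
       (auto simp: norm_mult infsum_cmult_right' infsum_nonneg intro!: summable_on_cmult_right g)
qed

lemma has_sum_mult_Times:
  fixes f :: "'a \<Rightarrow> complex" and g :: "'b \<Rightarrow> complex"
  assumes f: "(\<lambda>x. norm (f x)) summable_on A" and g: "(\<lambda>x. norm (g x)) summable_on B"
    and S: "(f has_sum S) A" and T: "(g has_sum T) B"
  shows "((\<lambda>z. f (fst z) * g (snd z)) has_sum S * T) (A \<times> B)"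
proof (rule has_sum_SigmaI)
  show "((\<lambda>x. f x * T) has_sum S * T) A" by (rule has_sum_cmult_left[OF S])
  show "((\<lambda>y. f (fst (x, y)) * g (snd (x, y))) has_sum f x * T) B" for x
    using has_sum_cmult_right[OF T] by simp
  show "(\<lambda>z. f (fst z) * g (snd z)) summable_on A \<times> B"
    by (rule abs_summable_summable[OF summable_on_norm_mult_Times[OF f g]])
qed

lemma has_sum_sum_finite:
  fixes f :: "'i \<Rightarrow> 'a \<Rightarrow> complex"
  assumes "finite I" and "\<And>i. i \<in> I \<Longrightarrow> (f i has_sum S i) A"
  shows "((\<lambda>x. \<Sum>i\<in>I. f i x) has_sum (\<Sum>i\<in>I. S i)) A"
  using assms by (induction I rule: finite_induct) (auto intro!: has_sum_add)

lemma summable_norm_ratio_tendsto: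
  fixes f c :: "nat \<Rightarrow> complex"
  assumes "\<And>n. f (Suc n) = c n * f n" and "c \<longlonglongrightarrow> L" and "norm L < 1"
  shows "summable (\<lambda>n. norm (f n))"
proof -
  obtain r where r: "norm L < r" "r < 1" using assms(3) dense by blast
  have "(\<lambda>n. norm (c n)) \<longlonglongrightarrow> norm L" by (intro tendsto_norm assms)
  hence "eventually (\<lambda>n. norm (c n) < r) sequentially" using r(1) by (rule order_tendstoD)
  then obtain n0 where "\<And>n. n \<ge> n0 \<Longrightarrow> norm (c n) < r" by (auto simp: eventually_sequentially)
  thus ?thesis
    using r(2) by (intro summable_ratio_test[of r n0]) (auto simp: assms(1) norm_mult intro!: mult_right_mono dest: less_imp_le)
qed

context
  fixes q :: complex
  assumes q0: "0 < norm q" and q1: "norm q < 1"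
begin

section \<open>The q-binomial theorem and its reciprocal\<close>

lemma q_power_neq_1: "1 - q ^ Suc n \<noteq> 0"
proof -
  have "norm (q ^ Suc n) < 1"
    using power_Suc_less_one[OF q0 q1, of n] by (simp add: norm_power norm_mult)
  thus ?thesis by auto
qed

lemma qpoch_q_nonzero: "qpoch q q n \<noteq> 0"
  using q_power_neq_1 by (induction n) (auto simp: qpoch_Suc)

lemma q_binomial_0 [simp]: "q_binomial q n 0 = 1"
  by (simp add: q_binomial_def qpoch_q_nonzero)

lemma q_binomial_self [simp]: "q_binomial q n n = 1"
  by (simp add: q_binomial_def qpoch_q_nonzero)

lemma q_binomial_Suc:
  "q_binomial q (Suc n) (Suc k) = q ^ Suc k * q_binomial q n (Suc k) + q_binomial q n k"
proof -
  consider (lt) "k < n" | (eq) "k = n" | (gt) "k > n" by linarith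
  thus ?thesis
  proof cases
    case lt
    then obtain d where n: "n = Suc (k + d)" using less_imp_Suc_add by blast
    have nz: "qpoch q q k \<noteq> 0" "qpoch q q d \<noteq> 0" "1 - q * q ^ k \<noteq> 0" "1 - q * q ^ d \<noteq> 0"
      using qpoch_q_nonzero q_power_neq_1[of k] q_power_neq_1[of d] by auto
    have "q * q ^ k \<noteq> 1" "q * q ^ d \<noteq> 1" using nz by auto
    thus ?thesis using nz
      by (simp add: n q_binomial_def Suc_diff_le qpoch_Suc power_add divide_simps) (simp add: algebra_simps)
  qed (simp_all add: q_binomial_eq_0)
qed

lemma q_binomial_Suc':
  assumes "k \<le> n"
  shows "q_binomial q (Suc n) (Suc k) = q_binomial q n (Suc k) + q ^ (n - k) * q_binomial q n k"
proof (cases "k = n")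
  case False
  with assms obtain d where n: "n = Suc (k + d)" using less_imp_Suc_add le_neq_implies_less by blast
  have "q_binomial q (Suc n) (Suc k) = q_binomial q (Suc n) (Suc d)"
    using q_binomial_symmetric[of "Suc k" "Suc n"] n by simp
  also have "\<dots> = q ^ Suc d * q_binomial q n (Suc d) + q_binomial q n d"
    by (rule q_binomial_Suc)
  also have "q_binomial q n (Suc d) = q_binomial q n k"
    using q_binomial_symmetric[of "k" "n"] n by simp
  also have "q_binomial q n d = q_binomial q n (Suc k)"
    using q_binomial_symmetric[of "Suc k" "n"] n by simp
  finally show ?thesis by (simp add: n)
qed (simp add: q_binomial_eq_0)

text \<open>
  The \<open>q\<close>-binomial theorem of Rothe and Gauss, read off coefficientwise. Its evaluation at a complex number is
  \<open>q_binomial_theorem\<close>.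
\<close>

lemma fps_nth_fps_qpoch: "fps_nth (fps_qpoch y q n) k = theta_term q y k * q_binomial q n k"
proof (induction n arbitrary: k)
  case 0
  show ?case by (cases k) (simp_all add: fps_qpoch_def q_binomial_eq_0)
next
  case (Suc n)
  have rec: "fps_nth (fps_qpoch y q (Suc n)) k = fps_nth (fps_qpoch y q n) k
      - y * q ^ n * (if k = 0 then 0 else fps_nth (fps_qpoch y q n) (k - 1))" for k
    by (simp add: fps_qpoch_Suc fps_nth_mult_linear del: fps_const_mult)
  show ?case
  proof (cases k)
    case 0
    thus ?thesis by (simp add: rec Suc)
  next
    case [simp]: (Suc l)
    show ?thesis
    proof (cases "l \<le> n")
      case True
      have "q ^ n = q ^ l * q ^ (n - l)"
        using True by (simp flip: power_add)
      thus ?thesis using True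
        by (simp add: rec Suc.IH q_binomial_Suc' theta_term_Suc algebra_simps)
    qed (simp add: rec Suc.IH q_binomial_eq_0)
  qed
qed

lemma q_binomial_theorem: "qpoch x q n = (\<Sum>k\<le>n. theta_term q x k * q_binomial q n k)"
proof (induction n)
  case (Suc n)
  have "(\<Sum>k\<le>Suc n. theta_term q x k * q_binomial q (Suc n) k)
      = 1 + (\<Sum>k\<le>n. theta_term q x (Suc k) * q_binomial q (Suc n) (Suc k))"
    by (subst sum.atMost_Suc_shift) simp
  also have "(\<Sum>k\<le>n. theta_term q x (Suc k) * q_binomial q (Suc n) (Suc k))
      = (\<Sum>k\<le>n. theta_term q x (Suc k) * q_binomial q n (Suc k)
           - x * q ^ n * (theta_term q x k * q_binomial q n k))"
  proof (intro sum.cong refl)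
    fix k assume "k \<in> {..n}"
    hence k: "k \<le> n" "q ^ n = q ^ k * q ^ (n - k)" by (simp_all flip: power_add)
    show "theta_term q x (Suc k) * q_binomial q (Suc n) (Suc k) = theta_term q x (Suc k) * q_binomial q n (Suc k)
           - x * q ^ n * (theta_term q x k * q_binomial q n k)"
      unfolding k(2) using k(1) by (simp add: q_binomial_Suc' theta_term_Suc algebra_simps)
  qed
  also have "\<dots> = (\<Sum>k\<le>n. theta_term q x (Suc k) * q_binomial q n (Suc k)) - x * q ^ n * qpoch x q n"
    by (simp add: sum_subtractf Suc sum_distrib_left)
  also have "1 + \<dots> = (\<Sum>k\<le>Suc n. theta_term q x k * q_binomial q n k) - x * q ^ n * qpoch x q n"
    by (subst sum.atMost_Suc_shift) simp
  also have "\<dots> = qpoch x q n - x * q ^ n * qpoch x q n"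
    by (simp add: q_binomial_eq_0 Suc)
  finally show ?case by (simp add: qpoch_Suc algebra_simps)
qed simp

text \<open>
  Multiplication of the series for \<open>i + 1\<close> by its last linear factor \<open>1 - q\<^bsup>i+1\<^esup>x\<close> is, coefficientwise,
  the Pascal rule \<open>q_binomial_Suc\<close>, and it gives the series for \<open>i\<close>.
\<close>

lemma fps_q_negbinomial_inverse: "fps_q_negbinomial q i * fps_qpoch 1 q (Suc i) = 1"
proof (induction i)
  case 0
  show ?case
    unfolding fps_qpoch_Suc mult.assoc[symmetric]
    by (rule fps_ext, subst fps_nth_mult_linear) (simp add: fps_q_negbinomial_def fps_qpoch_def)
next
  case (Suc i)
  have step: "fps_q_negbinomial q (Suc i) * (1 - fps_const (q ^ Suc i) * fps_X) = fps_q_negbinomial q i"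
  proof (rule fps_ext)
    fix l
    show "fps_nth (fps_q_negbinomial q (Suc i) * (1 - fps_const (q ^ Suc i) * fps_X)) l
        = fps_nth (fps_q_negbinomial q i) l"
      unfolding fps_nth_mult_linear
      by (cases l) (simp_all add: fps_q_negbinomial_def q_binomial_Suc q_binomial_eq_0)
  qed
  have "fps_q_negbinomial q (Suc i) * fps_qpoch 1 q (Suc (Suc i))
      = (fps_q_negbinomial q (Suc i) * (1 - fps_const (q ^ Suc i) * fps_X)) * fps_qpoch 1 q (Suc i)"
    unfolding fps_qpoch_Suc[of _ _ "Suc i"] mult_1_left by (simp only: mult_ac)
  thus ?case using Suc by (simp only: step)
qed

section \<open>Infinite products and the two series of Euler\<close>

lemma tendsto_q_power: "(\<lambda>n. q ^ n) \<longlonglongrightarrow> 0"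
  using q1 by (rule LIMSEQ_power_zero)

lemma summable_norm_theta_term: "summable (\<lambda>n. norm (theta_term q x n))"
proof (rule summable_norm_ratio_tendsto)
  show "(\<lambda>n. - x * q ^ n) \<longlonglongrightarrow> - x * 0" by (intro tendsto_intros tendsto_q_power)
qed (simp_all add: theta_term_Suc)

lemma summable_norm_theta_term_div_qpoch: "summable (\<lambda>n. norm (theta_term q x n / qpoch q q n))"
proof (rule summable_norm_ratio_tendsto)
  show "(\<lambda>n. - x * q ^ n / (1 - q * q ^ n)) \<longlonglongrightarrow> - x * 0 / (1 - q * 0)"
    by (intro tendsto_intros tendsto_q_power) auto
qed (simp_all add: theta_term_Suc qpoch_Suc)

lemma summable_norm_power_div_qpoch:
  assumes "norm z < 1"
  shows "summable (\<lambda>n. norm (z ^ n / qpoch q q n))"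
proof (rule summable_norm_ratio_tendsto)
  show "(\<lambda>n. z / (1 - q * q ^ n)) \<longlonglongrightarrow> z / (1 - q * 0)"
    by (intro tendsto_intros tendsto_q_power) auto
qed (simp_all add: qpoch_Suc assms)

lemma qpoch_LIMSEQ: "(\<lambda>n. qpoch x q n) \<longlonglongrightarrow> qpoch_inf x q"
  unfolding qpoch_def qpoch_inf_def LIMSEQ_lessThan_iff_atMost
  by (rule convergent_prod_LIMSEQ[OF convergent_prod_qpoch[OF q1]])

lemma qpoch_inf_split: "qpoch_inf x q = qpoch x q n * qpoch_inf (x * q ^ n) q"
proof (rule LIMSEQ_unique)
  show "(\<lambda>k. qpoch x q (n + k)) \<longlonglongrightarrow> qpoch_inf x q"
    using LIMSEQ_ignore_initial_segment[OF qpoch_LIMSEQ, of x n] by (simp add: add.commute)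
  show "(\<lambda>k. qpoch x q (n + k)) \<longlonglongrightarrow> qpoch x q n * qpoch_inf (x * q ^ n) q"
    unfolding qpoch_add by (intro tendsto_intros qpoch_LIMSEQ)
qed

lemma qpoch_inf_nonzero:
  assumes "\<And>n. qpoch x q n \<noteq> 0"
  shows "qpoch_inf x q \<noteq> 0"
  unfolding qpoch_inf_def
proof (rule prodinf_nonzero)
  show "1 - x * q ^ i \<noteq> 0" for i using assms[of "Suc i"] by (simp add: qpoch_Suc)
qed (rule convergent_prod_qpoch[OF q1])

text \<open>
  Continuity at \<open>0\<close>. Together with a first-order \<open>q\<close>-difference equation it determines a power series from
  its constant term, which is how both theorems of Euler are proved.
\<close>

lemma powser_q_power_LIMSEQ:
  assumes "K \<noteq> 0" and "summable (\<lambda>n. c n * K ^ n)"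
  shows "(\<lambda>k. \<Sum>n. c n * (x * q ^ k) ^ n) \<longlonglongrightarrow> (c 0 :: complex)"
proof -
  have "isCont (\<lambda>x. \<Sum>n. c n * x ^ n) 0"
    using assms by (intro isCont_powser[of _ K]) auto
  moreover have "(\<lambda>k. x * q ^ k) \<longlonglongrightarrow> x * 0"
    by (intro tendsto_intros tendsto_q_power)
  ultimately have "(\<lambda>k. \<Sum>n. c n * (x * q ^ k) ^ n) \<longlonglongrightarrow> (\<Sum>n. c n * 0 ^ n)"
    using isCont_tendsto_compose by (simp only: mult_zero_right) blast
  thus ?thesis by simp
qed

text \<open>
  Euler's expansion of \<open>(x;q)\<^sub>\<infinity>\<close>: the series \<open>g\<close> satisfies \<open>g(x) = (1 - x) g(xq)\<close>, hence
  \<open>g(x) = (x;q)\<^sub>k g(xq\<^sup>k)\<close>, and \<open>g(xq\<^sup>k)\<close> tends to \<open>g(0) = 1\<close>.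
\<close>

lemma has_sum_theta_term_div_qpoch: "((\<lambda>n. theta_term q x n / qpoch q q n) has_sum qpoch_inf x q) UNIV"
proof -
  define g where "g x = (\<Sum>n. theta_term q x n / qpoch q q n)" for x
  have summ: "summable (\<lambda>n. theta_term q x n / qpoch q q n)" for x
    by (rule summable_norm_cancel[OF summable_norm_theta_term_div_qpoch])
  have fe: "g x = (1 - x) * g (x * q)" for x
  proof -
    have "(\<lambda>n. theta_term q x n / qpoch q q n - theta_term q (x * q) n / qpoch q q n) sums (g x - g (x * q))"
      unfolding g_def by (intro sums_diff summable_sums summ)
    hence "(\<lambda>n. theta_term q x (Suc n) / qpoch q q (Suc n) - theta_term q (x * q) (Suc n) / qpoch q q (Suc n)) sums (g x - g (x * q))"
      by (subst sums_Suc_iff) simp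
    also have "(\<lambda>n. theta_term q x (Suc n) / qpoch q q (Suc n) - theta_term q (x * q) (Suc n) / qpoch q q (Suc n))
        = (\<lambda>n. - x * (theta_term q (x * q) n / qpoch q q n))"
    proof
      fix n
      have "theta_term q x (Suc n) - theta_term q (x * q) (Suc n) = - x * theta_term q (x * q) n * (1 - q ^ Suc n)"
        unfolding theta_term_mult theta_term_Suc by (simp add: algebra_simps)
      moreover have "qpoch q q (Suc n) = qpoch q q n * (1 - q ^ Suc n)" by (simp add: qpoch_Suc)
      ultimately show "theta_term q x (Suc n) / qpoch q q (Suc n) - theta_term q (x * q) (Suc n) / qpoch q q (Suc n)
          = - x * (theta_term q (x * q) n / qpoch q q n)"
        using q_power_neq_1[of n] by (simp add: diff_divide_distrib[symmetric] del: power_Suc)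
    qed
    finally have "(\<lambda>n. - x * (theta_term q (x * q) n / qpoch q q n)) sums (g x - g (x * q))" .
    moreover have "(\<lambda>n. - x * (theta_term q (x * q) n / qpoch q q n)) sums (- x * g (x * q))"
      unfolding g_def by (intro sums_mult summable_sums summ)
    ultimately have "g x - g (x * q) = - x * g (x * q)" by (rule sums_unique2)
    thus ?thesis by (simp add: algebra_simps)
  qed
  have "g x = qpoch x q k * g (x * q ^ k)" for k
  proof (induction k)
    case (Suc k)
    thus ?case using fe[of "x * q ^ k"] by (simp add: qpoch_Suc mult_ac)
  qed simp
  moreover have "g y = (\<Sum>n. theta_term q 1 n / qpoch q q n * y ^ n)" for y
    unfolding g_def by (rule suminf_cong) (use theta_term_mult[of q 1 y] in simp)
  hence "(\<lambda>k. g (x * q ^ k)) \<longlonglongrightarrow> 1"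
    using powser_q_power_LIMSEQ[of 1 "\<lambda>n. theta_term q 1 n / qpoch q q n" x] summ[of 1] by simp
  hence "(\<lambda>k. qpoch x q k * g (x * q ^ k)) \<longlonglongrightarrow> qpoch_inf x q * 1"
    by (intro tendsto_intros qpoch_LIMSEQ)
  ultimately have "g x = qpoch_inf x q"
    by (simp add: LIMSEQ_const_iff)
  thus ?thesis
    using norm_summable_imp_has_sum[OF summable_norm_theta_term_div_qpoch summable_sums[OF summ], of x]
    by (simp add: g_def)
qed

text \<open>
  Euler's expansion of \<open>1/(z;q)\<^sub>\<infinity>\<close>: here the series \<open>h\<close> satisfies \<open>h(zq) = (1 - z) h(z)\<close>, so that
  \<open>(z;q)\<^sub>k h(z) = h(zq\<^sup>k)\<close> tends to \<open>h(0) = 1\<close>.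
\<close>

lemma has_sum_power_div_qpoch:
  assumes "norm z < 1"
  shows "((\<lambda>n. z ^ n / qpoch q q n) has_sum 1 / qpoch_inf z q) UNIV"
proof -
  define h where "h z = (\<Sum>n. z ^ n / qpoch q q n)" for z
  have summ: "summable (\<lambda>n. z ^ n / qpoch q q n)" if "norm z < 1" for z
    by (rule summable_norm_cancel[OF summable_norm_power_div_qpoch[OF that]])
  have small: "norm (z * q ^ k) < 1" for k
  proof -
    have "norm z * norm q ^ k \<le> norm z * 1" using q1 by (intro mult_left_mono power_le_one) auto
    thus ?thesis using assms by (simp add: norm_mult norm_power)
  qed
  have fe: "h (x * q) = (1 - x) * h x" if x: "norm x < 1" "norm (x * q) < 1" for x
  proof -
    have "(\<lambda>n. x ^ n / qpoch q q n - (x * q) ^ n / qpoch q q n) sums (h x - h (x * q))"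
      unfolding h_def by (intro sums_diff summable_sums summ x)
    hence "(\<lambda>n. x ^ Suc n / qpoch q q (Suc n) - (x * q) ^ Suc n / qpoch q q (Suc n)) sums (h x - h (x * q))"
      by (subst sums_Suc_iff) simp
    also have "(\<lambda>n. x ^ Suc n / qpoch q q (Suc n) - (x * q) ^ Suc n / qpoch q q (Suc n))
        = (\<lambda>n. x * (x ^ n / qpoch q q n))"
    proof
      fix n
      have "x ^ Suc n - (x * q) ^ Suc n = x * x ^ n * (1 - q ^ Suc n)"
        by (simp add: power_mult_distrib algebra_simps)
      moreover have "qpoch q q (Suc n) = qpoch q q n * (1 - q ^ Suc n)" by (simp add: qpoch_Suc)
      ultimately show "x ^ Suc n / qpoch q q (Suc n) - (x * q) ^ Suc n / qpoch q q (Suc n) = x * (x ^ n / qpoch q q n)"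
        using q_power_neq_1[of n] by (simp add: diff_divide_distrib[symmetric] del: power_Suc)
    qed
    finally have "(\<lambda>n. x * (x ^ n / qpoch q q n)) sums (h x - h (x * q))" .
    moreover have "(\<lambda>n. x * (x ^ n / qpoch q q n)) sums (x * h x)"
      unfolding h_def by (intro sums_mult summable_sums summ x)
    ultimately have "h x - h (x * q) = x * h x" by (rule sums_unique2)
    thus ?thesis by (simp add: algebra_simps)
  qed
  have "h (z * q ^ k) = qpoch z q k * h z" for k
  proof (induction k)
    case (Suc k)
    thus ?case using fe[of "z * q ^ k"] small[of k] small[of "Suc k"] by (simp add: qpoch_Suc mult_ac)
  qed simp
  moreover have "(\<lambda>k. h (z * q ^ k)) \<longlonglongrightarrow> 1"
    using powser_q_power_LIMSEQ[of q "\<lambda>n. 1 / qpoch q q n" z] summ[OF q1] q0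
    by (simp add: h_def)
  moreover have "(\<lambda>k. qpoch z q k * h z) \<longlonglongrightarrow> qpoch_inf z q * h z"
    by (intro tendsto_intros qpoch_LIMSEQ)
  ultimately have "qpoch_inf z q * h z = 1"
    by (simp add: LIMSEQ_unique)
  hence "h z = 1 / qpoch_inf z q" by (metis eq_divide_imp mult.commute mult_zero_left zero_neq_one)
  thus ?thesis
    using norm_summable_imp_has_sum[OF summable_norm_power_div_qpoch[OF assms] summable_sums[OF summ[OF assms]]]
    by (simp add: h_def)
qed

section \<open>Evaluation of Q by the Bailey chain\<close>

text \<open>
  A case of the \<open>q\<close>-Chu--Vandermonde sum. Division by \<open>(cq;q)\<^sub>n\<close> and \<open>n \<rightarrow> \<infinity>\<close> turn it into Cauchy's identity
  on Durfee squares. By the Pascal rule the sum for \<open>n + 1\<close> and \<open>c\<close> equals the sum for \<open>n\<close> and \<open>cq\<close>: the two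
  parts into which the rule splits it have, after a shift of the index in one of them, proportional
  summands with ratio \<open>1 - cq\<^bsup>l+1\<^esup>\<close> to \<open>cq\<^bsup>l+1\<^esup>\<close>.
\<close>

lemma sum_q_binomial_Durfee:
  "(\<Sum>l\<le>n. c ^ l * q ^ (l * l) * q_binomial q n l * qpoch (c * q ^ Suc l) q (n - l)) = 1"
proof (induction n arbitrary: c)
  case (Suc n)
  define R where "R l = qpoch (c * q ^ Suc l) q (Suc n - l)" for l
  define S where "S l = qpoch (c * q * q ^ Suc l) q (n - l)" for l
  have R: "R l = (1 - c * q ^ Suc l) * S l" if "l \<le> n" for l
    using that by (simp add: R_def S_def Suc_diff_le qpoch_Suc_left mult_ac)
  have RS: "R (Suc l) = S l" for l
    by (simp add: R_def S_def mult_ac)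
  have "(\<Sum>l\<le>Suc n. c ^ l * q ^ (l * l) * q_binomial q (Suc n) l * R l)
      = R 0 + (\<Sum>l\<le>n. c ^ Suc l * q ^ (Suc l * Suc l) * q_binomial q (Suc n) (Suc l) * R (Suc l))"
    by (subst sum.atMost_Suc_shift) simp
  also have "\<dots> = (R 0 + (\<Sum>l\<le>n. (c * q) ^ Suc l * q ^ (Suc l * Suc l) * q_binomial q n (Suc l) * R (Suc l)))
      + (\<Sum>l\<le>n. c ^ Suc l * q ^ (Suc l * Suc l) * q_binomial q n l * R (Suc l))"
    by (simp add: q_binomial_Suc sum.distrib algebra_simps)
  also have "R 0 + (\<Sum>l\<le>n. (c * q) ^ Suc l * q ^ (Suc l * Suc l) * q_binomial q n (Suc l) * R (Suc l))
      = (\<Sum>l\<le>Suc n. (c * q) ^ l * q ^ (l * l) * q_binomial q n l * R l)"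
    by (subst sum.atMost_Suc_shift) simp
  also have "\<dots> = (\<Sum>l\<le>n. (c * q) ^ l * q ^ (l * l) * q_binomial q n l * R l)"
    by (simp add: q_binomial_eq_0)
  also have "\<dots> + (\<Sum>l\<le>n. c ^ Suc l * q ^ (Suc l * Suc l) * q_binomial q n l * R (Suc l))
      = (\<Sum>l\<le>n. (c * q) ^ l * q ^ (l * l) * q_binomial q n l * S l)"
    unfolding sum.distrib[symmetric]
    by (intro sum.cong refl) (simp add: R RS power_add power_mult_distrib algebra_simps)
  also have "\<dots> = 1"
    unfolding S_def by (rule Suc)
  finally show ?case unfolding R_def .
qed simp

text \<open>
  The transfer rule of Bailey's lemma with both free parameters sent to infinity. After the shift \<open>j = r + l\<close>
  it is the preceding lemma at \<open>c = bq\<^bsup>2r\<^esup>\<close>.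
\<close>

lemma sum_q_binomial_Bailey:
  assumes "r \<le> N" and nz: "qpoch (b * q ^ r) q (Suc N) \<noteq> 0"
  shows "(\<Sum>j\<le>N. b ^ j * q ^ (j * j) * q_binomial q N j * (q_binomial q j r / qpoch (b * q ^ r) q (Suc j)))
    = b ^ r * q ^ (r * r) * q_binomial q N r / qpoch (b * q ^ r) q (Suc N)"
proof -
  obtain n where N: "N = r + n" using assms(1) le_Suc_ex by blast
  define c where "c = b * q ^ (2 * r)"
  have inv: "1 / qpoch (b * q ^ r) q (Suc (r + l)) = qpoch (c * q ^ Suc l) q (n - l) / qpoch (b * q ^ r) q (Suc N)"
    if "l \<le> n" for l
  proof -
    have "Suc N = Suc (r + l) + (n - l)" using that N by simp
    hence *: "qpoch (b * q ^ r) q (Suc N) = qpoch (b * q ^ r) q (Suc (r + l)) * qpoch (b * q ^ r * q ^ Suc (r + l)) q (n - l)"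
      by (simp only: qpoch_add)
    have "b * q ^ r * q ^ Suc (r + l) = c * q ^ Suc l"
      by (simp add: c_def power_add mult_2 mult_2_right mult_ac)
    note * = *[unfolded this]
    show ?thesis using nz unfolding * by (simp del: power_Suc)
  qed
  have bin: "q_binomial q N (r + l) * q_binomial q (r + l) r = q_binomial q N r * q_binomial q n l"
    if "l \<le> n" for l
    using that qpoch_q_nonzero by (simp add: N q_binomial_def)
  have "(\<Sum>j\<le>N. b ^ j * q ^ (j * j) * q_binomial q N j * (q_binomial q j r / qpoch (b * q ^ r) q (Suc j)))
      = (\<Sum>j=r..N. b ^ j * q ^ (j * j) * q_binomial q N j * (q_binomial q j r / qpoch (b * q ^ r) q (Suc j)))"
    by (intro sum.mono_neutral_right) (auto simp: q_binomial_eq_0)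
  also have "\<dots> = (\<Sum>l\<le>n. b ^ (r + l) * q ^ ((r + l) * (r + l)) * q_binomial q N (r + l) *
      (q_binomial q (r + l) r / qpoch (b * q ^ r) q (Suc (r + l))))"
    by (intro sum.reindex_bij_witness[of _ "\<lambda>l. r + l" "\<lambda>j. j - r"]) (auto simp: N)
  also have "\<dots> = (\<Sum>l\<le>n. b ^ r * q ^ (r * r) * q_binomial q N r / qpoch (b * q ^ r) q (Suc N) *
      (c ^ l * q ^ (l * l) * q_binomial q n l * qpoch (c * q ^ Suc l) q (n - l)))"
  proof (intro sum.cong refl)
    fix l assume "l \<in> {..n}"
    hence l: "l \<le> n" by simp
    have sq: "(r + l) * (r + l) = r * r + 2 * r * l + l * l" by (simp add: algebra_simps)
    have "b ^ (r + l) * q ^ ((r + l) * (r + l)) = b ^ r * q ^ (r * r) * (c ^ l * q ^ (l * l))"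
      unfolding sq c_def power_add power_mult_distrib power_mult[symmetric] by (simp only: mult_ac)
    hence "b ^ (r + l) * q ^ ((r + l) * (r + l)) * q_binomial q N (r + l) *
      (q_binomial q (r + l) r / qpoch (b * q ^ r) q (Suc (r + l))) =
      b ^ r * q ^ (r * r) * (c ^ l * q ^ (l * l)) * (q_binomial q N (r + l) * q_binomial q (r + l) r) *
        (1 / qpoch (b * q ^ r) q (Suc (r + l)))"
      by simp
    thus "b ^ (r + l) * q ^ ((r + l) * (r + l)) * q_binomial q N (r + l) *
      (q_binomial q (r + l) r / qpoch (b * q ^ r) q (Suc (r + l))) =
      b ^ r * q ^ (r * r) * q_binomial q N r / qpoch (b * q ^ r) q (Suc N) *
      (c ^ l * q ^ (l * l) * q_binomial q n l * qpoch (c * q ^ Suc l) q (n - l))"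
      unfolding inv[OF l] bin[OF l] by (simp only: times_divide_eq_right times_divide_eq_left mult_ac mult_1_left)
  qed
  also have "\<dots> = b ^ r * q ^ (r * r) * q_binomial q N r / qpoch (b * q ^ r) q (Suc N)"
    by (simp only: sum_distrib_left[symmetric] sum_q_binomial_Durfee mult_1_right)
  finally show ?thesis .
qed

text \<open>
  The left-hand side (times \<open>(q;q)\<^sub>N\<close>) of the defining relation of a Bailey pair relative to \<open>b\<close>, for the
  pair obtained from the unit Bailey pair by \<open>s\<close> steps of the Bailey chain. The factor
  \<open>e\<^sub>i(1) (1 - bq\<^bsup>2i\<^esup>)\<close> comes from the unit pair, and each step contributes \<open>b\<^sup>i q\<^bsup>i\<^sup>2\<^esup>\<close>.
\<close>

definition bailey_sum :: "nat \<Rightarrow> nat \<Rightarrow> complex \<Rightarrow> complex" where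
  "bailey_sum s N b = (\<Sum>i\<le>N. theta_term q 1 i * (b ^ i * q ^ (i * i)) ^ s *
     (1 - b * q ^ (2 * i)) * (q_binomial q N i / qpoch (b * q ^ i) q (Suc N)))"

text \<open>
  The sum of the unit Bailey pair telescopes: all its partial sums have a closed form, which vanishes once
  \<open>p\<close> exceeds \<open>N\<close>.
\<close>

lemma bailey_sum_0_partial:
  assumes "\<And>i. i \<le> Suc N \<Longrightarrow> qpoch (b * q ^ i) q (Suc (Suc N)) \<noteq> 0" and "p \<le> Suc N"
  shows "(\<Sum>i\<le>p. theta_term q 1 i * (1 - b * q ^ (2 * i)) *
      (q_binomial q (Suc N) i / qpoch (b * q ^ i) q (Suc (Suc N))))
    = theta_term q 1 p * q ^ p * q_binomial q N p / qpoch (b * q ^ Suc p) q (Suc N)"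
  using assms(2)
proof (induction p)
  case 0
  have "qpoch b q (Suc (Suc N)) = (1 - b) * qpoch (b * q) q (Suc N)"
    by (rule qpoch_Suc_left)
  with assms(1)[of 0] show ?case by simp
next
  case (Suc p)
  define D where "D = qpoch (b * q ^ Suc (Suc p)) q N"
  define B where "B = 1 - b * q ^ Suc p"
  define C where "C = 1 - b * q ^ (Suc (Suc p) + N)"
  have shift: "b * q ^ Suc p * q = b * q ^ Suc (Suc p)" by simp
  have DC: "qpoch (b * q ^ Suc (Suc p)) q (Suc N) = D * C"
    by (simp only: qpoch_Suc D_def C_def power_add mult.assoc)
  have eqs: "qpoch (b * q ^ Suc p) q (Suc N) = B * D"
    "qpoch (b * q ^ Suc p) q (Suc (Suc N)) = B * (D * C)"
    "qpoch (b * q ^ Suc (Suc p)) q (Suc N) = D * C"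
    unfolding qpoch_Suc_left[of "b * q ^ Suc p"] shift DC by (simp_all only: B_def D_def)
  have nz: "B \<noteq> 0" "C \<noteq> 0" "D \<noteq> 0"
    using assms(1)[of "Suc p"] Suc.prems eqs by auto
  define X Y Z where "X = q_binomial q (Suc N) (Suc p)" and "Y = q_binomial q N (Suc p)" and "Z = q_binomial q N p"
  define u v where "u = q ^ Suc p" and "v = q ^ (N - p)"
  \<comment> \<open>the two Pascal rules, with the powers of \<open>q\<close> made opaque\<close>
  have XYZ: "X = u * Y + Z" "X = Y + v * Z"
    unfolding X_def Y_def Z_def u_def v_def 
    by (rule q_binomial_Suc) (rule q_binomial_Suc', use Suc.prems in simp)
  have BC: "B = 1 - b * u" "C = 1 - b * (u * u * v)" "q ^ (2 * Suc p) = u * u"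
    using Suc.prems by (simp_all add: B_def C_def u_def v_def mult_2 flip: power_add power_Suc)
  \<comment> \<open>the coefficients of 1 and of \<open>b\<close> are compared by the two Pascal rules, respectively\<close>
  have key: "X * (1 - b * (u * u)) - Z * C = u * Y * B"
  proof -
    have "X * (1 - b * (u * u)) = X - b * (u * u) * X" by (simp add: algebra_simps)
    also have "\<dots> = (u * Y + Z) - b * (u * u) * (Y + v * Z)" using XYZ by metis
    finally show ?thesis unfolding BC by (simp add: algebra_simps)
  qed
  have "(\<Sum>i\<le>Suc p. theta_term q 1 i * (1 - b * q ^ (2 * i)) *
      (q_binomial q (Suc N) i / qpoch (b * q ^ i) q (Suc (Suc N))))
    = theta_term q 1 p * q ^ p * Z / (B * D) +
      theta_term q 1 (Suc p) * (1 - b * (u * u)) * (X / (B * (D * C)))"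
    using Suc by (simp only: sum.atMost_Suc eqs X_def Z_def BC(3))
  also have "\<dots> = theta_term q 1 (Suc p) * (X * (1 - b * (u * u)) - Z * C) / (B * (D * C))"
    using nz by (simp add: theta_term_Suc divide_simps) (simp add: algebra_simps)
  also have "\<dots> = theta_term q 1 (Suc p) * u * Y / (D * C)"
    unfolding key using nz by simp
  finally show ?case by (simp only: u_def Y_def eqs)
qed

lemma bailey_sum_0:
  assumes "\<And>i. i \<le> N \<Longrightarrow> qpoch (b * q ^ i) q (Suc N) \<noteq> 0"
  shows "bailey_sum 0 N b = (if N = 0 then 1 else 0)"
proof (cases N)
  case 0
  thus ?thesis using assms[of 0] by (simp add: bailey_sum_def qpoch_Suc)
next
  case (Suc M)
  thus ?thesis using bailey_sum_0_partial[of M b N] assms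
    by (simp add: bailey_sum_def q_binomial_eq_0)
qed

text \<open>
  One step of the Bailey chain: after an interchange of the two summations the sum over \<open>j\<close> is evaluated by
  \<open>sum_q_binomial_Bailey\<close>.
\<close>

lemma bailey_sum_Suc:
  assumes nz: "\<And>i. i \<le> N \<Longrightarrow> qpoch (b * q ^ i) q (Suc N) \<noteq> 0"
  shows "bailey_sum (Suc s) N b = (\<Sum>j\<le>N. b ^ j * q ^ (j * j) * q_binomial q N j * bailey_sum s j b)"
proof -
  define \<alpha> where "\<alpha> i = theta_term q 1 i * (b ^ i * q ^ (i * i)) ^ s * (1 - b * q ^ (2 * i))" for i
  have "bailey_sum s j b = (\<Sum>i\<le>N. \<alpha> i * (q_binomial q j i / qpoch (b * q ^ i) q (Suc j)))"
    if "j \<le> N" for j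
    unfolding bailey_sum_def \<alpha>_def using that
    by (intro sum.mono_neutral_left) (auto simp: q_binomial_eq_0)
  hence "(\<Sum>j\<le>N. b ^ j * q ^ (j * j) * q_binomial q N j * bailey_sum s j b)
      = (\<Sum>j\<le>N. \<Sum>i\<le>N. \<alpha> i * (b ^ j * q ^ (j * j) * q_binomial q N j *
           (q_binomial q j i / qpoch (b * q ^ i) q (Suc j))))"
    by (simp add: sum_distrib_left mult_ac)
  also have "\<dots> = (\<Sum>i\<le>N. \<Sum>j\<le>N. \<alpha> i * (b ^ j * q ^ (j * j) * q_binomial q N j *
           (q_binomial q j i / qpoch (b * q ^ i) q (Suc j))))"
    by (rule sum.swap)
  also have "\<dots> = (\<Sum>i\<le>N. \<alpha> i * (b ^ i * q ^ (i * i) * q_binomial q N i / qpoch (b * q ^ i) q (Suc N)))"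
    by (intro sum.cong refl) (simp only: sum_distrib_left[symmetric] sum_q_binomial_Bailey nz atMost_iff not_False_eq_True)
  also have "\<dots> = bailey_sum (Suc s) N b"
    unfolding bailey_sum_def \<alpha>_def by (intro sum.cong refl) (simp add: mult_ac)
  finally show ?thesis by simp
qed

text \<open>
  The first step turns the unit sequence into the constant sequence \<open>1\<close>, and the second step sums this constant.
\<close>

lemma bailey_sum_2:
  assumes nz: "\<And>i. i \<le> N \<Longrightarrow> qpoch (b * q ^ i) q (Suc N) \<noteq> 0"
  shows "bailey_sum 2 N b = (\<Sum>j\<le>N. b ^ j * q ^ (j * j) * q_binomial q N j)"
proof -
  have nz': "qpoch (b * q ^ i) q (Suc j) \<noteq> 0" if "i \<le> j" "j \<le> N" for i j
  proof -
    have "Suc N = Suc j + (N - j)" using that by simp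
    hence "qpoch (b * q ^ i) q (Suc N) = qpoch (b * q ^ i) q (Suc j) * qpoch (b * q ^ i * q ^ Suc j) q (N - j)"
      by (simp only: qpoch_add)
    thus ?thesis using nz[of i] that by auto
  qed
  have one: "bailey_sum 1 j b = 1" if "j \<le> N" for j
  proof -
    have "bailey_sum 1 j b = (\<Sum>i\<le>j. b ^ i * q ^ (i * i) * q_binomial q j i * bailey_sum 0 i b)"
      using bailey_sum_Suc[of j b 0] nz' that by simp
    also have "\<dots> = (\<Sum>i\<le>j. if i = 0 then 1 else 0)"
    proof (intro sum.cong refl)
      fix i assume "i \<in> {..j}"
      thus "b ^ i * q ^ (i * i) * q_binomial q j i * bailey_sum 0 i b = (if i = 0 then 1 else 0)"
        using bailey_sum_0[of i b] nz' that by auto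
    qed
    finally show ?thesis by simp
  qed
  show ?thesis
    using bailey_sum_Suc[of N b 1] nz one by (simp add: numeral_2_eq_2)
qed

text \<open>
  Each factor satisfies \<open>q\<^sup>N (1 - q\<^bsup>l-N\<^esup>) = -q\<^sup>l (1 - q\<^bsup>N-l\<^esup>)\<close>. This is the form in which
  \<open>(q\<^bsup>-N\<^esup>;q)\<^sub>i\<close>, with the factor \<open>q\<^bsup>Ni\<^esup>\<close> that accompanies it in \<open>Q\<close>, becomes a Gaussian binomial.
\<close>

lemma qpoch_negative_power:
  assumes "i \<le> N"
  shows "qpoch (1 / q ^ N) q i * q ^ (N * i) = theta_term q 1 i * q_binomial q N i * qpoch q q i"
  using assms
proof (induction i)
  case (Suc i)
  obtain d where N: "N = Suc (i + d)" using Suc.prems less_imp_Suc_add[of i N] by auto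
  have nz: "q \<noteq> 0" "1 - q * q ^ d \<noteq> 0" "1 - q * q ^ i \<noteq> 0"
    using q0 q_power_neq_1[of d] q_power_neq_1[of i] by auto
  have "q_binomial q N (Suc i) * qpoch q q (Suc i) = q_binomial q N i * qpoch q q i * (1 - q ^ Suc d)"
    using qpoch_q_nonzero nz by (simp add: N q_binomial_def Suc_diff_le qpoch_Suc)
  hence "theta_term q 1 (Suc i) * q_binomial q N (Suc i) * qpoch q q (Suc i)
      = - (q ^ i) * (1 - q ^ Suc d) * (theta_term q 1 i * q_binomial q N i * qpoch q q i)"
    by (simp add: theta_term_Suc mult_ac)
  also have "\<dots> = - (q ^ i) * (1 - q ^ Suc d) * (qpoch (1 / q ^ N) q i * q ^ (N * i))"
    using Suc by simp
  also have "- (q ^ i) * (1 - q ^ Suc d) = q ^ N * (1 - 1 / q ^ N * q ^ i)"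
    using nz by (simp add: N power_add field_simps)
  finally show ?case by (simp add: qpoch_Suc power_add mult_ac)
qed simp

lemma Q_eq_sum:
  assumes nz: "Q_denoms_nonzero q (N + 2) b"
  shows "Q q (N + 2) b = (\<Sum>j\<le>N. b ^ j * q ^ (j * j) * q_binomial q N j)"
proof -
  have "q \<noteq> 0" using q0 by auto
  have nz': "qpoch (b * q ^ i) q (Suc N) \<noteq> 0" if "i \<le> N" for i
    using nz that by (auto simp: Q_denoms_nonzero_def)
  have "Q q (N + 2) b = bailey_sum 2 N b"
    unfolding Q_def bailey_sum_def atLeast0AtMost
  proof (intro sum.cong)
    fix i assume "i \<in> {..N}"
    hence i: "i \<le> N" by simp
    have e1: "q powi (2 - int (N + 2)) = 1 / q ^ N"
      by (simp add: power_int_minus field_simps)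
    have "(2 * int i - 2 + int (N + 2)) * int i = int (2 * (i * i) + N * i)"
      by (simp add: algebra_simps)
    hence e2: "q powi ((2 * int i - 2 + int (N + 2)) * int i) = q ^ (2 * (i * i)) * q ^ (N * i)"
      by (simp only: power_int_of_nat power_add)
    have e3: "qpoch (1 / q ^ N) q i * q ^ (N * i) / qpoch q q i = theta_term q 1 i * q_binomial q N i"
      using qpoch_negative_power[OF i] qpoch_q_nonzero by simp
    have "N + 2 - 1 = Suc N" by simp
    show "qpoch (q powi (2 - int (N + 2))) q i / (qpoch q q i * qpoch (b * q ^ i) q (N + 2 - 1)) *
         (1 - b * q ^ (2 * i)) * b ^ (2 * i) * q powi ((2 * int i - 2 + int (N + 2)) * int i) =
         theta_term q 1 i * (b ^ i * q ^ (i * i)) ^ 2 * (1 - b * q ^ (2 * i)) *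
         (q_binomial q N i / qpoch (b * q ^ i) q (Suc N))" (is "?L = ?R")
    proof -
      have "?L = (qpoch (1 / q ^ N) q i * q ^ (N * i) / qpoch q q i) * (b ^ i * q ^ (i * i)) ^ 2 *
          (1 - b * q ^ (2 * i)) / qpoch (b * q ^ i) q (Suc N)"
        unfolding e1 e2 \<open>N + 2 - 1 = Suc N\<close> by (simp add: power_mult_distrib power_mult[symmetric] mult_ac)
      also have "\<dots> = ?R" unfolding e3 by simp
      finally show ?thesis .
    qed
  qed simp
  thus ?thesis using bailey_sum_2[of N b] nz' by simp
qed

section \<open>Expansion of P in powers of both parameters\<close>

text \<open>
  The general term of the quadruple series. The indices \<open>r\<close>, \<open>s\<close>, \<open>t\<close> come from the expansions of
  \<open>(cq\<^sup>n;q)\<^sub>n\<close>, \<open>(aq\<^sup>n;q)\<^sub>\<infinity>\<close> and \<open>(bq\<^sup>n;q)\<^sub>\<infinity>\<close>. Since \<open>r \<le> n\<close>, the outer index is written as \<open>n = r + l\<close>,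
  which makes all four indices range freely.
\<close>

definition quad_term :: "complex \<Rightarrow> complex \<Rightarrow> complex \<Rightarrow> (nat \<times> nat) \<times> (nat \<times> nat) \<Rightarrow> complex" where
  "quad_term a b c = (\<lambda>((l, r), (s, t)). qpoch_inf q q * q ^ ((r + l) * Suc (r + s + t)) *
     (theta_term q c r * theta_term q a s * theta_term q b t) /
     (qpoch q q l * qpoch q q r * qpoch q q s * qpoch q q t))"

text \<open>
  The exponent \<open>(r + l)(1 + r + s + t)\<close> is at least \<open>l\<close>. Dropping the rest of it leaves a product of four
  absolutely convergent simple series of Euler type.
\<close>

lemma summable_norm_quad_term: "(\<lambda>z. norm (quad_term a b c z)) summable_on UNIV"
proof -
  define E where "E x n = theta_term q x n / qpoch q q n" for x n
  define F where "F n = q ^ n / qpoch q q n" for n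
  have E: "(\<lambda>n. norm (E x n)) summable_on UNIV" for x
    unfolding E_def using norm_summable_imp_summable_on[of "\<lambda>n. norm (theta_term q x n / qpoch q q n)"]
      summable_norm_theta_term_div_qpoch by simp
  have F: "(\<lambda>n. norm (F n)) summable_on UNIV"
    unfolding F_def using norm_summable_imp_summable_on[of "\<lambda>n. norm (q ^ n / qpoch q q n)"]
      summable_norm_power_div_qpoch[OF q1] by simp
  have "(\<lambda>z. norm (F (fst z) * E c (snd z))) summable_on UNIV \<times> UNIV"
    using F E by (rule summable_on_norm_mult_Times)
  moreover have "(\<lambda>z. norm (E a (fst z) * E b (snd z))) summable_on UNIV \<times> UNIV"
    using E E by (rule summable_on_norm_mult_Times)
  ultimately have "(\<lambda>z. norm ((F (fst (fst z)) * E c (snd (fst z))) * (E a (fst (snd z)) * E b (snd (snd z)))))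
      summable_on (UNIV \<times> UNIV) \<times> (UNIV \<times> UNIV)"
    by (rule summable_on_norm_mult_Times)
  hence "(\<lambda>z. norm (qpoch_inf q q) * norm ((F (fst (fst z)) * E c (snd (fst z))) * (E a (fst (snd z)) * E b (snd (snd z)))))
      summable_on UNIV"
    by (intro summable_on_cmult_right) simp
  thus ?thesis
  proof (rule Infinite_Sum.abs_summable_on_comparison_test')
    fix z :: "(nat \<times> nat) \<times> (nat \<times> nat)"
    obtain l r s t where z: "z = ((l, r), (s, t))" by (metis surj_pair)
    define e where "e = r * Suc (r + s + t) + l * (r + s + t)"
    have le: "norm q ^ e \<le> 1"
      using q1 by (intro power_le_one) auto
    have e: "(r + l) * Suc (r + s + t) = e + l"
      by (simp add: e_def algebra_simps)
    have "norm (quad_term a b c z) = norm q ^ e * (norm (qpoch_inf q q) * norm ((F l * E c r) * (E a s * E b t)))"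
      unfolding z quad_term_def prod.case E_def F_def e
      by (simp add: norm_mult norm_divide norm_power power_add mult_ac)
    also have "\<dots> \<le> 1 * (norm (qpoch_inf q q) * norm ((F l * E c r) * (E a s * E b t)))"
      by (intro mult_right_mono le) simp
    finally show "norm (quad_term a b c z) \<le> norm (qpoch_inf q q) * norm ((F (fst (fst z)) * E c (snd (fst z))) * (E a (fst (snd z)) * E b (snd (snd z))))"
      by (simp add: z)
  qed
qed

text \<open>
  For fixed \<open>r\<close>, \<open>s\<close>, \<open>t\<close> the sum over \<open>l\<close> is Euler's series for \<open>1/(q\<^bsup>r+s+t+1\<^esup>;q)\<^sub>\<infinity>\<close>, and the factor
  \<open>(q;q)\<^sub>\<infinity>\<close> reduces this to the finite product \<open>(q;q)\<^bsub>r+s+t\<^esub>\<close>.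
\<close>

lemma has_sum_quad_term_l:
  "((\<lambda>l. quad_term a b c ((l, r), (s, t))) has_sum
     q ^ (r * Suc (r + s + t)) * (theta_term q c r * theta_term q a s * theta_term q b t) *
       (qpoch q q (r + s + t) / (qpoch q q r * qpoch q q s * qpoch q q t))) UNIV"
proof -
  define n where "n = Suc (r + s + t)"
  define K where "K = qpoch_inf q q * q ^ (r * n) * (theta_term q c r * theta_term q a s * theta_term q b t) /
       (qpoch q q r * qpoch q q s * qpoch q q t)"
  have "norm (q ^ n) < 1"
    using power_Suc_less_one[OF q0 q1, of "r + s + t"] by (simp only: n_def norm_power)
  hence "((\<lambda>l. K * ((q ^ n) ^ l / qpoch q q l)) has_sum K * (1 / qpoch_inf (q ^ n) q)) UNIV"
    by (intro has_sum_cmult_right has_sum_power_div_qpoch)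
  moreover have "qpoch_inf q q = qpoch q q (r + s + t) * qpoch_inf (q ^ n) q"
    using qpoch_inf_split[of q "r + s + t"] by (simp add: n_def)
  moreover have "qpoch_inf q q \<noteq> 0"
    by (rule qpoch_inf_nonzero) (rule qpoch_q_nonzero)
  ultimately have "((\<lambda>l. K * ((q ^ n) ^ l / qpoch q q l)) has_sum
      q ^ (r * n) * (theta_term q c r * theta_term q a s * theta_term q b t) *
       (qpoch q q (r + s + t) / (qpoch q q r * qpoch q q s * qpoch q q t))) UNIV"
    by (simp add: K_def mult_ac)
  moreover have "K * ((q ^ n) ^ l / qpoch q q l) = quad_term a b c ((l, r), (s, t))" for l
  proof -
    have "q ^ ((r + l) * n) = q ^ (r * n) * (q ^ n) ^ l"
      by (simp add: add_mult_distrib power_add mult.commute[of l] power_mult)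
    thus ?thesis unfolding quad_term_def K_def prod.case n_def[symmetric] by (simp add: mult_ac)
  qed
  ultimately show ?thesis by (simp add: n_def)
qed

lemma has_sum_quad_term_st:
  assumes "r \<le> n"
  shows "((\<lambda>z. quad_term a b c ((n - r, r), z)) has_sum
     q ^ n * qpoch_inf (q ^ Suc n) q * qpoch_inf (a * q ^ n) q * qpoch_inf (b * q ^ n) q *
       (theta_term q (c * q ^ n) r * q_binomial q n r)) UNIV"
proof -
  define K where "K = q ^ n * qpoch_inf (q ^ Suc n) q * (theta_term q (c * q ^ n) r * q_binomial q n r)"
  have "((\<lambda>z. (theta_term q (a * q ^ n) (fst z) / qpoch q q (fst z)) * (theta_term q (b * q ^ n) (snd z) / qpoch q q (snd z)))
      has_sum qpoch_inf (a * q ^ n) q * qpoch_inf (b * q ^ n) q) (UNIV \<times> UNIV)"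
    using norm_summable_imp_summable_on[of "\<lambda>i. norm (theta_term q x i / qpoch q q i)" for x]
      summable_norm_theta_term_div_qpoch
    by (intro has_sum_mult_Times has_sum_theta_term_div_qpoch) simp_all
  hence "((\<lambda>z. K * ((theta_term q (a * q ^ n) (fst z) / qpoch q q (fst z)) * (theta_term q (b * q ^ n) (snd z) / qpoch q q (snd z))))
      has_sum K * (qpoch_inf (a * q ^ n) q * qpoch_inf (b * q ^ n) q)) UNIV"
    by (intro has_sum_cmult_right) simp
  moreover have "K * ((theta_term q (a * q ^ n) (fst z) / qpoch q q (fst z)) * (theta_term q (b * q ^ n) (snd z) / qpoch q q (snd z)))
      = quad_term a b c ((n - r, r), z)" for z
  proof -
    obtain s t where z: "z = (s, t)" by (metis surj_pair)
    have "qpoch_inf q q = qpoch q q n * qpoch_inf (q ^ Suc n) q"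
      using qpoch_inf_split[of q n] by simp
    hence K: "K = q ^ n * qpoch_inf q q * theta_term q (c * q ^ n) r / (qpoch q q r * qpoch q q (n - r))"
      using assms qpoch_q_nonzero by (simp add: K_def q_binomial_def)
    have "(r + (n - r)) * Suc (r + s + t) = n + n * r + n * s + n * t"
      using assms by (simp add: algebra_simps)
    hence "q ^ ((r + (n - r)) * Suc (r + s + t)) = q ^ n * (q ^ n) ^ r * (q ^ n) ^ s * (q ^ n) ^ t"
      by (simp only: power_add power_mult)
    thus ?thesis
      by (simp add: quad_term_def z K theta_term_mult mult_ac)
  qed
  ultimately show ?thesis by (simp add: K_def mult_ac)
qed

text \<open>
  The same quadruple series is summed in two orders. The common value \<open>S\<close> is left abstract, because only the
  equality of both sides is of interest. As long as \<open>c\<close> is independent of \<open>a\<close> and \<open>b\<close>, each coefficient is a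
  single term; a finite sum arises only from the specialization \<open>c = ab/q\<^sup>m\<close>.
\<close>

lemma trivariate_expansion:
  obtains S where
    "((\<lambda>n. q ^ n * qpoch_inf (q ^ Suc n) q * qpoch_inf (a * q ^ n) q * qpoch_inf (b * q ^ n) q * qpoch (c * q ^ n) q n)
       has_sum S) UNIV"
    "((\<lambda>(r, s, t). q ^ (r * Suc (r + s + t)) * (theta_term q c r * theta_term q a s * theta_term q b t) *
       (qpoch q q (r + s + t) / (qpoch q q r * qpoch q q s * qpoch q q t))) has_sum S) UNIV"
proof
  define S where "S = infsum (quad_term a b c) UNIV"
  have S: "(quad_term a b c has_sum S) UNIV"
    unfolding S_def by (rule has_sum_infsum[OF abs_summable_summable[OF summable_norm_quad_term]])
  have "((\<lambda>((n, r), z). quad_term a b c ((n - r, r), z)) has_sum S) ((SIGMA n:UNIV. {..n}) \<times> UNIV)"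
    by (rule iffD1[OF has_sum_reindex_bij_witness[where i = "\<lambda>((n, r), z). ((n - r, r), z)"
          and j = "\<lambda>((l, r), z). ((l + r, r), z)"] S]) auto
  hence "((\<lambda>(n, r). q ^ n * qpoch_inf (q ^ Suc n) q * qpoch_inf (a * q ^ n) q * qpoch_inf (b * q ^ n) q *
       (theta_term q (c * q ^ n) r * q_binomial q n r)) has_sum S) (SIGMA n:UNIV. {..n})"
  proof (rule has_sum_SigmaD, goal_cases)
    case (1 nr)
    then obtain n r where "nr = (n, r)" "r \<le> n" by auto
    with has_sum_quad_term_st[of r n a b c] show ?case by (simp only: prod.case)
  qed
  thus "((\<lambda>n. q ^ n * qpoch_inf (q ^ Suc n) q * qpoch_inf (a * q ^ n) q * qpoch_inf (b * q ^ n) q * qpoch (c * q ^ n) q n)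
       has_sum S) UNIV"
  proof (rule has_sum_SigmaD)
    fix n :: nat
    show "((\<lambda>r. case (n, r) of (n, r) \<Rightarrow> q ^ n * qpoch_inf (q ^ Suc n) q * qpoch_inf (a * q ^ n) q * qpoch_inf (b * q ^ n) q *
       (theta_term q (c * q ^ n) r * q_binomial q n r)) has_sum
       q ^ n * qpoch_inf (q ^ Suc n) q * qpoch_inf (a * q ^ n) q * qpoch_inf (b * q ^ n) q * qpoch (c * q ^ n) q n) {..n}"
      by (rule has_sum_finiteI) (simp_all add: q_binomial_theorem sum_distrib_left)
  qed
  have "((\<lambda>((r, s, t), l). quad_term a b c ((l, r), (s, t))) has_sum S) (UNIV \<times> UNIV)"
    by (rule iffD1[OF has_sum_reindex_bij_witness[where i = "\<lambda>((r, s, t), l). ((l, r), (s, t))"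
          and j = "\<lambda>((l, r), (s, t)). ((r, s, t), l)"] S]) auto
  thus "((\<lambda>(r, s, t). q ^ (r * Suc (r + s + t)) * (theta_term q c r * theta_term q a s * theta_term q b t) *
       (qpoch q q (r + s + t) / (qpoch q q r * qpoch q q s * qpoch q q t))) has_sum S) UNIV"
  proof (rule has_sum_SigmaD, goal_cases)
    case (1 rst)
    obtain r s t where "rst = (r, s, t)" by (metis surj_pair)
    with has_sum_quad_term_l[of a b c r s t] show ?case by (simp only: prod.case)
  qed
qed

text \<open>
  Once \<open>(ab/q\<^sup>m;q)\<^bsub>2n\<^esub>\<close> is divided by \<open>(ab/q\<^sup>m;q)\<^sub>n\<close> and the infinite products are split at \<open>n\<close>, the terms of \<open>P\<close>
  are those of the trivariate expansion. The prefactor \<open>K\<close> is nonzero, so convergence passes through it.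
\<close>

lemma P_eq_has_sum:
  assumes "P_denoms_nonzero q m a b"
  assumes "((\<lambda>n. q ^ n * qpoch_inf (q ^ Suc n) q * qpoch_inf (a * q ^ n) q * qpoch_inf (b * q ^ n) q *
     qpoch (a * b / q ^ m * q ^ n) q n) has_sum S) UNIV"
  shows "P q m a b = S"
proof -
  define c where "c = a * b / q ^ m"
  define K where "K = qpoch_inf q q * qpoch_inf a q * qpoch_inf b q"
  have nz: "qpoch a q n \<noteq> 0" "qpoch b q n \<noteq> 0" "qpoch c q n \<noteq> 0" for n
    using assms(1) by (auto simp: P_denoms_nonzero_def qpochs_def c_def)
  have "K \<noteq> 0"
    unfolding K_def using nz qpoch_q_nonzero by (simp add: qpoch_inf_nonzero)
  have "q ^ n * qpoch_inf (q ^ Suc n) q * qpoch_inf (a * q ^ n) q * qpoch_inf (b * q ^ n) q * qpoch (c * q ^ n) q n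
      = K * (qpoch c q (2 * n) / qpochs [q, a, b, c] q n * q ^ n)" for n
    unfolding K_def qpoch_inf_split[of q n] qpoch_inf_split[of a n] qpoch_inf_split[of b n] mult_2 qpoch_add
    using nz[of n] qpoch_q_nonzero[of n] by (simp add: qpochs_def)
  hence "(\<lambda>n. K * (qpoch c q (2 * n) / qpochs [q, a, b, c] q n * q ^ n)) sums S"
    using has_sum_imp_sums[OF assms(2)] by (simp add: c_def)
  hence "(\<lambda>n. qpoch c q (2 * n) / qpochs [q, a, b, c] q n * q ^ n) sums (S / K)"
    using sums_divide[of _ S K] \<open>K \<noteq> 0\<close> by (fastforce simp: mult.assoc)
  thus ?thesis using \<open>K \<noteq> 0\<close>
    by (simp add: P_def qpochs_inf_def K_def c_def sums_iff mult_ac)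
qed

text \<open>
  The coefficient of \<open>e\<^sub>i(a) e\<^sub>j(b)\<close> in \<open>P\<close> for \<open>m = N + 2\<close>, defined through its generating function in \<open>j\<close>.
\<close>

definition P_coeff :: "nat \<Rightarrow> nat \<Rightarrow> nat \<Rightarrow> complex" where
  "P_coeff N i j = fps_nth (fps_qpoch (1 / q ^ N) q i * fps_q_negbinomial q i) j"

text \<open>
  The powers of \<open>q\<close> for \<open>c = ab/q\<^sup>m\<close>: those joining \<open>r\<close> with \<open>s\<close> and with \<open>t\<close> are absorbed into \<open>e\<^bsub>r+s\<^esub>(a)\<close> and
  \<open>e\<^bsub>r+t\<^esub>(b)\<close>, and those in \<open>r\<close> alone collapse to a single theta term at \<open>q\<^bsup>2-m\<^esup>\<close>.
\<close>

lemma theta_term_regroup: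
  "q ^ (r * Suc (r + s + t)) * (theta_term q (a * b / q ^ (N + 2)) r * theta_term q a s * theta_term q b t)
   = theta_term q a (r + s) * theta_term q b (r + t) * theta_term q (1 / q ^ N) r"
proof -
  have "q ^ (r * Suc r) * theta_term q (a * b / q ^ (N + 2)) r = theta_term q a r * theta_term q b r * theta_term q (1 / q ^ N) r"
    using q0 by (induction r) (simp_all add: theta_term_Suc power_add field_simps power2_eq_square)
  moreover have "q ^ (r * Suc (r + s + t)) = q ^ (r * Suc r) * q ^ (r * s) * q ^ (r * t)"
    by (simp add: power_add[symmetric] algebra_simps)
  ultimately show ?thesis by (simp add: theta_term_add mult_ac)
qed

text \<open>
  With \<open>i = r + s\<close> and \<open>j = r + t\<close> the quotient \<open>(q;q)\<^bsub>r+s+t\<^esub>/((q;q)\<^sub>r (q;q)\<^sub>s (q;q)\<^sub>t)\<close> becomes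
  \<open>[i,r] [i + j - r, i]\<close>, and the finite sum over \<open>r\<close> is a Cauchy product of the two series in \<open>P_coeff\<close>.
\<close>

lemma P_expansion:
  assumes "P_denoms_nonzero q (N + 2) a b"
  shows "((\<lambda>(i, j). theta_term q a i * theta_term q b j * P_coeff N i j) has_sum P q (N + 2) a b) UNIV"
proof -
  define f where "f = (\<lambda>(r, s, t). q ^ (r * Suc (r + s + t)) *
       (theta_term q (a * b / q ^ (N + 2)) r * theta_term q a s * theta_term q b t) *
       (qpoch q q (r + s + t) / (qpoch q q r * qpoch q q s * qpoch q q t)))"
  define g where "g i j r = theta_term q a i * theta_term q b j *
      ((theta_term q (1 / q ^ N) r * q_binomial q i r) * q_binomial q (i + (j - r)) i)" for i j r
  obtain S where S: "((\<lambda>n. q ^ n * qpoch_inf (q ^ Suc n) q * qpoch_inf (a * q ^ n) q * qpoch_inf (b * q ^ n) q *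
     qpoch (a * b / q ^ (N + 2) * q ^ n) q n) has_sum S) UNIV" "(f has_sum S) UNIV"
    unfolding f_def using trivariate_expansion by blast
  have fg: "f (r, s, t) = g (r + s) (r + t) r" for r s t
    unfolding f_def prod.case theta_term_regroup g_def
    using qpoch_q_nonzero by (simp add: q_binomial_def add.assoc mult.assoc)
  have "((\<lambda>((i, j), r). g i j r) has_sum S) (SIGMA (i, j):UNIV. {..min i j})"
    by (rule iffD1[OF has_sum_reindex_bij_witness[where i = "\<lambda>((i, j), r). (r, i - r, j - r)"
          and j = "\<lambda>(r, s, t). ((r + s, r + t), r)"] S(2)]) (auto simp: fg)
  hence "((\<lambda>(i, j). theta_term q a i * theta_term q b j * P_coeff N i j) has_sum S) UNIV"
  proof (rule has_sum_SigmaD)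
    fix ij :: "nat \<times> nat"
    obtain i j where ij: "ij = (i, j)" by (metis surj_pair)
    have "(\<Sum>r\<le>min i j. g i j r) = (\<Sum>r\<le>j. g i j r)"
      by (intro sum.mono_neutral_left) (auto simp: g_def q_binomial_eq_0)
    also have "\<dots> = theta_term q a i * theta_term q b j * P_coeff N i j"
      by (simp add: P_coeff_def fps_mult_nth fps_nth_fps_qpoch fps_q_negbinomial_def g_def
            sum_distrib_left atLeast0AtMost)
    finally show "((\<lambda>r. case (ij, r) of (ij, r) \<Rightarrow> (case ij of (i, j) \<Rightarrow> g i j) r) has_sum
        (case ij of (i, j) \<Rightarrow> theta_term q a i * theta_term q b j * P_coeff N i j)) (case ij of (i, j) \<Rightarrow> {..min i j})"
      unfolding ij prod.case by (intro has_sum_finiteI) simp_all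
  qed
  thus ?thesis using P_eq_has_sum[OF assms S(1)] by simp
qed

section \<open>Separation of the two variables\<close>

text \<open>
  The reason for the theorem: the right-hand side does not involve \<open>i\<close>. The factors
  \<open>(xq\<^bsup>-N\<^esup>;q)\<^sub>i\<close> and \<open>(xq\<^bsup>i-N\<^esup>;q)\<^bsub>N+1\<^esub>\<close> join to a product of length \<open>N + 1 + i\<close>, which can be cut again after
  \<open>N\<close> factors; its second part is then exactly the denominator \<open>(x;q)\<^bsub>i+1\<^esub>\<close>.
\<close>

lemma P_coeff_convolution:
  "(\<Sum>k\<le>j. theta_term q (q ^ i / q ^ N) k * q_binomial q (Suc N) k * P_coeff N i (j - k))
   = theta_term q (1 / q ^ N) j * q_binomial q N j"
proof -
  let ?F = "\<lambda>y n. fps_qpoch y q n"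
  have "?F (q ^ i / q ^ N) (Suc N) * (?F (1 / q ^ N) i * fps_q_negbinomial q i)
      = ?F (1 / q ^ N) (i + Suc N) * fps_q_negbinomial q i"
    by (simp only: fps_qpoch_add[of _ _ i] mult_ac) simp
  also have "i + Suc N = N + Suc i" by simp
  also have "?F (1 / q ^ N) (N + Suc i) * fps_q_negbinomial q i = ?F (1 / q ^ N) N * (fps_q_negbinomial q i * ?F 1 (Suc i))"
    unfolding fps_qpoch_add[of _ _ N] using q0 by (simp add: mult_ac)
  also have "\<dots> = ?F (1 / q ^ N) N" by (simp add: fps_q_negbinomial_inverse)
  finally have "fps_nth (?F (q ^ i / q ^ N) (Suc N) * (?F (1 / q ^ N) i * fps_q_negbinomial q i)) j
      = fps_nth (?F (1 / q ^ N) N) j" by simp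
  thus ?thesis
    unfolding fps_mult_nth[of "?F (q ^ i / q ^ N) (Suc N)"] P_coeff_def[symmetric]
    by (simp only: fps_nth_fps_qpoch atLeast0AtMost)
qed

text \<open>
  The \<open>k\<close>-th weight together with the arguments \<open>aq\<^sup>k\<close> and \<open>bq\<^sup>k\<close> shifts the index \<open>j\<close> by \<open>k\<close>, so that summing over
  \<open>k\<close> produces the convolution of the preceding lemma in every coefficient. The result factors into a
  series in \<open>i\<close> and a finite sum over \<open>j\<close>.
\<close>

lemma weighted_sum_P:
  assumes nz: "\<forall>k\<in>{0..Suc N}. P_denoms_nonzero q (N + 2) (a * q ^ k) (b * q ^ k)"
  shows "(\<Sum>k\<le>Suc N. q_binomial q (Suc N) k * (b * q ^ k / q ^ Suc N) ^ k * P q (N + 2) (a * q ^ k) (b * q ^ k))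
    = partial_theta q a * (\<Sum>j\<le>N. (b / q ^ Suc N) ^ j * q ^ (j * j) * q_binomial q N j)"
proof -
  have "q \<noteq> 0" using q0 by auto
  define h where "h i j k = (if k \<le> j then theta_term q a i * theta_term q b j *
       (theta_term q (q ^ i / q ^ N) k * q_binomial q (Suc N) k * P_coeff N i (j - k)) else 0)" for i j k
  have shift: "(b * q ^ k / q ^ Suc N) ^ k * (theta_term q (a * q ^ k) i * theta_term q (b * q ^ k) j)
     = theta_term q a i * theta_term q b (j + k) * theta_term q (q ^ i / q ^ N) k" for i j k
  proof -
    have "theta_term q b k * theta_term q (q * (q ^ i / q ^ Suc N)) k = (b * (q ^ i / q ^ Suc N)) ^ k * q ^ (k * k)"
      by (rule theta_term_mult_theta_term)
    moreover have "q * (q ^ i / q ^ Suc N) = q ^ i / q ^ N" using \<open>q \<noteq> 0\<close> by simp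
    moreover have "(b * (q ^ i / q ^ Suc N)) ^ k * q ^ (k * k) = (b * q ^ k / q ^ Suc N) ^ k * (q ^ k) ^ i"
      by (simp add: power_mult_distrib power_divide power_mult[symmetric] mult_ac)
    ultimately have "theta_term q b k * theta_term q (q ^ i / q ^ N) k = (b * q ^ k / q ^ Suc N) ^ k * (q ^ k) ^ i"
      by simp
    thus ?thesis
      by (simp add: theta_term_add theta_term_mult power_mult[symmetric] mult_ac)
  qed
  have "((\<lambda>(i, j). h i j k) has_sum
      q_binomial q (Suc N) k * (b * q ^ k / q ^ Suc N) ^ k * P q (N + 2) (a * q ^ k) (b * q ^ k)) UNIV"
    if k: "k \<le> Suc N" for k
  proof -
    have "((\<lambda>ij. q_binomial q (Suc N) k * (b * q ^ k / q ^ Suc N) ^ k *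
        (case ij of (i, j) \<Rightarrow> theta_term q (a * q ^ k) i * theta_term q (b * q ^ k) j * P_coeff N i j)) has_sum
        q_binomial q (Suc N) k * (b * q ^ k / q ^ Suc N) ^ k * P q (N + 2) (a * q ^ k) (b * q ^ k)) UNIV"
      using nz k by (intro has_sum_cmult_right P_expansion) auto
    also have "(\<lambda>ij. q_binomial q (Suc N) k * (b * q ^ k / q ^ Suc N) ^ k *
        (case ij of (i, j) \<Rightarrow> theta_term q (a * q ^ k) i * theta_term q (b * q ^ k) j * P_coeff N i j))
        = (\<lambda>(i, j). h i (j + k) k)"
    proof (intro ext, clarify)
      fix i j
      have "q_binomial q (Suc N) k * (b * q ^ k / q ^ Suc N) ^ k *
          (theta_term q (a * q ^ k) i * theta_term q (b * q ^ k) j * P_coeff N i j)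
          = ((b * q ^ k / q ^ Suc N) ^ k * (theta_term q (a * q ^ k) i * theta_term q (b * q ^ k) j)) *
            q_binomial q (Suc N) k * P_coeff N i j"
        by (simp only: mult_ac)
      also have "\<dots> = h i (j + k) k" unfolding shift h_def by simp
      finally show "q_binomial q (Suc N) k * (b * q ^ k / q ^ Suc N) ^ k *
          (theta_term q (a * q ^ k) i * theta_term q (b * q ^ k) j * P_coeff N i j) = h i (j + k) k" .
    qed
    finally have "((\<lambda>(i, j). h i j k) has_sum
      q_binomial q (Suc N) k * (b * q ^ k / q ^ Suc N) ^ k * P q (N + 2) (a * q ^ k) (b * q ^ k)) (UNIV \<times> {k..})"
      by (rule iffD1[OF has_sum_reindex_bij_witness[where i = "\<lambda>(i, j). (i, j - k)"
          and j = "\<lambda>(i, j). (i, j + k)"], rotated -1]) auto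
    thus ?thesis
      by (rule iffD1[OF has_sum_cong_neutral, rotated -1]) (auto simp: h_def split: if_splits)
  qed
  hence "((\<lambda>ij. \<Sum>k\<le>Suc N. case ij of (i, j) \<Rightarrow> h i j k) has_sum
      (\<Sum>k\<le>Suc N. q_binomial q (Suc N) k * (b * q ^ k / q ^ Suc N) ^ k * P q (N + 2) (a * q ^ k) (b * q ^ k))) UNIV"
    by (intro has_sum_sum_finite) auto
  moreover have "(\<Sum>k\<le>Suc N. h i j k) = theta_term q a i * (theta_term q b j *
      (theta_term q (1 / q ^ N) j * q_binomial q N j))" for i j
  proof -
    \<comment> \<open>both ranges are enlarged to a common one: \<open>h\<close> vanishes for \<open>k > j\<close>, and its binomial for \<open>k > Suc N\<close>\<close>
    have "(\<Sum>k\<le>Suc N. h i j k) = (\<Sum>k\<le>max (Suc N) j. h i j k)"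
      by (intro sum.mono_neutral_left) (auto simp: h_def q_binomial_eq_0)
    also have "\<dots> = (\<Sum>k\<le>j. h i j k)"
      by (intro sum.mono_neutral_right) (auto simp: h_def)
    also have "\<dots> = theta_term q a i * theta_term q b j *
       (\<Sum>k\<le>j. theta_term q (q ^ i / q ^ N) k * q_binomial q (Suc N) k * P_coeff N i (j - k))"
      by (simp add: h_def sum_distrib_left)
    finally show ?thesis unfolding P_coeff_convolution by (simp only: mult.assoc)
  qed
  ultimately have lhs: "((\<lambda>ij. theta_term q a (fst ij) * (theta_term q b (snd ij) *
      (theta_term q (1 / q ^ N) (snd ij) * q_binomial q N (snd ij)))) has_sum
      (\<Sum>k\<le>Suc N. q_binomial q (Suc N) k * (b * q ^ k / q ^ Suc N) ^ k * P q (N + 2) (a * q ^ k) (b * q ^ k))) UNIV"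
    by (simp add: case_prod_unfold)
  have theta: "(theta_term q a has_sum partial_theta q a) UNIV"
  proof -
    have "partial_theta q a = suminf (theta_term q a)"
      by (simp add: partial_theta_def theta_term_def[abs_def])
    thus ?thesis
      using norm_summable_imp_has_sum[OF summable_norm_theta_term
          summable_sums[OF summable_norm_cancel[OF summable_norm_theta_term]]] by simp
  qed
  have fin: "((\<lambda>j. theta_term q b j * (theta_term q (1 / q ^ N) j * q_binomial q N j)) has_sum
      (\<Sum>j\<le>N. theta_term q b j * (theta_term q (1 / q ^ N) j * q_binomial q N j))) UNIV"
    by (rule has_sum_finite_neutralI[of "{..N}"]) (auto simp: q_binomial_eq_0)
  have "((\<lambda>ij. theta_term q a (fst ij) * (theta_term q b (snd ij) *
      (theta_term q (1 / q ^ N) (snd ij) * q_binomial q N (snd ij)))) has_sum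
      partial_theta q a * (\<Sum>j\<le>N. theta_term q b j * (theta_term q (1 / q ^ N) j * q_binomial q N j))) (UNIV \<times> UNIV)"
  proof (rule has_sum_mult_Times[OF _ _ theta fin])
    show "(\<lambda>x. norm (theta_term q a x)) summable_on UNIV"
      using norm_summable_imp_summable_on[of "\<lambda>n. norm (theta_term q a n)"] summable_norm_theta_term by simp
    show "(\<lambda>j. norm (theta_term q b j * (theta_term q (1 / q ^ N) j * q_binomial q N j))) summable_on UNIV"
      by (rule has_sum_imp_summable[OF has_sum_finite_neutralI[of "{..N}"]]) (auto simp: q_binomial_eq_0)
  qed
  hence "(\<Sum>k\<le>Suc N. q_binomial q (Suc N) k * (b * q ^ k / q ^ Suc N) ^ k * P q (N + 2) (a * q ^ k) (b * q ^ k))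
      = partial_theta q a * (\<Sum>j\<le>N. theta_term q b j * (theta_term q (1 / q ^ N) j * q_binomial q N j))"
    using has_sum_unique[OF lhs] by (simp only: UNIV_Times_UNIV)
  also have "(\<Sum>j\<le>N. theta_term q b j * (theta_term q (1 / q ^ N) j * q_binomial q N j))
      = (\<Sum>j\<le>N. (b / q ^ Suc N) ^ j * q ^ (j * j) * q_binomial q N j)"
    by (intro sum.cong refl)
       (use theta_term_mult_theta_term[of q b _ "1 / q ^ Suc N"] \<open>q \<noteq> 0\<close> in simp)
  finally show ?thesis .
qed

text \<open>
  For \<open>n = m - 1\<close> the left-hand side is the quotient that occurs in the weights.
\<close>

lemma qpoch_top_quotient:
  assumes "k \<le> n"
  shows "qpoch (q ^ (Suc n - k)) q k / qpoch q q k = q_binomial q n k"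
proof -
  have "qpoch q q (n - k + k) = qpoch q q (n - k) * qpoch (q * q ^ (n - k)) q k"
    by (rule qpoch_add)
  thus ?thesis using assms qpoch_q_nonzero by (simp add: q_binomial_def Suc_diff_le)
qed

end

theorem theorem5:
  fixes q a b :: complex and m :: nat
  assumes "0 < norm q" and "norm q < 1"
    and "m \<ge> 2"
    and "\<forall>k\<in>{0..m-1}. P_denoms_nonzero q m (a * q ^ k) (b * q ^ k)"
    and "Q_denoms_nonzero q m (b * q powi (1 - int m))"
    and "Q q m (b * q powi (1 - int m)) \<noteq> 0"
  shows "partial_theta q a =
    (\<Sum>k=0..m-1. qpoch (q ^ (m - k)) q k * (b * q powi (int k - int m + 1)) ^ k /
       (qpoch q q k * Q q m (b * q powi (1 - int m))) * P q m (a * q ^ k) (b * q ^ k))"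
proof -
  note q = assms(1,2)
  have "q \<noteq> 0" using q by auto
  obtain N where m: "m = N + 2" using assms(3) le_Suc_ex by (metis add.commute)
  define d where "d = Q q m (b * q powi (1 - int m))"
  have shift: "q powi (int k - int m + 1) = q ^ k / q ^ Suc N" for k
  proof -
    have "int k - int m + 1 = int k - int (Suc N)" by (simp add: m)
    thus ?thesis using \<open>q \<noteq> 0\<close> power_int_diff[of q "int k" "int (Suc N)"]
      by (simp only: power_int_of_nat simp_thms)
  qed
  have d: "d = (\<Sum>j\<le>N. (b / q ^ Suc N) ^ j * q ^ (j * j) * q_binomial q N j)"
    using Q_eq_sum[OF q, of N "b * q powi (1 - int m)"] assms(5) shift[of 0] by (simp add: d_def m)
  have "(\<Sum>k=0..m-1. qpoch (q ^ (m - k)) q k * (b * q powi (int k - int m + 1)) ^ k /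
       (qpoch q q k * d) * P q m (a * q ^ k) (b * q ^ k))
      = (\<Sum>k\<le>Suc N. q_binomial q (Suc N) k * (b * q ^ k / q ^ Suc N) ^ k * P q (N + 2) (a * q ^ k) (b * q ^ k) / d)"
    unfolding atLeast0AtMost
  proof (intro sum.cong)
    fix k assume "k \<in> {..Suc N}"
    hence "q_binomial q (Suc N) k = qpoch (q ^ (m - k)) q k / qpoch q q k"
      using qpoch_top_quotient[OF q, of k "Suc N"] by (simp add: m)
    thus "qpoch (q ^ (m - k)) q k * (b * q powi (int k - int m + 1)) ^ k /
       (qpoch q q k * d) * P q m (a * q ^ k) (b * q ^ k) =
       q_binomial q (Suc N) k * (b * q ^ k / q ^ Suc N) ^ k * P q (N + 2) (a * q ^ k) (b * q ^ k) / d"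
      unfolding shift unfolding m by simp
  qed (simp add: m)
  also have "\<dots> = partial_theta q a * d / d"
    using weighted_sum_P[OF q, of N a b] assms(4) by (simp add: m d sum_divide_distrib[symmetric] del: sum.atMost_Suc)
  also have "\<dots> = partial_theta q a"
    using assms(6) by (simp add: d_def)
  finally show ?thesis by (simp add: d_def)
qed

end
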